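(* Let $p$ be a prime, $r\ge1$ and $n\ge1$ integers, let $S_0,S_1,\dots,S_{n-1}\in\mathbb{Z}_{p^r}$, put $S(x)=S_0x^n+S_1x^{n-1}+\dots+S_{n-1}x\in\mathbb{Z}_{p^r}[x]$, and let $M$ be the submodule of $\mathbb{Z}_{p^r}[x]^2$ spanned by $[\,1\ \ -S(x)\,]$ and $[\,0\ \ x^{n+1}\,]$. Let $(v_1,v_2,\dots,v_{2r})$ be a minimal TOP Gröbner $p$-basis of $M$, with $v_i$ written as $v_i=[\,d_i\ \ -h_i\,]\in\mathbb{Z}_{p^r}[x]^2$ for $i=1,\dots,2r$. Let $\ell\in\{1,\dots,2r\}$ be such that $\mathrm{lpos}(v_\ell)=1$ and $\mathrm{ord}(v_\ell)=r$. Then $d_\ell$ is a shortest linear recurrence relation for the sequence $S_0,\dots,S_{n-1}$. Furthermore, a parametrization of all shortest linear recurrence relations for $S_0,\dots,S_{n-1}$ is given by $$q_\ell d_\ell+\sum_{i>\ell}q_id_i,$$ with $0\ne q_\ell\in\mathcal{A}_p$ and $q_i\in\mathcal{A}_p[x]$ with $\deg q_i\le\deg v_\ell-\deg v_i$ for $i=\ell+1,\dots,2r$; that is, the set of all shortest linear recurrence relations for $S_0,\dots,S_{n-1}$ is exactly the set of polynomials of this form.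
   Context: Linear recurrence relation: a polynomial $f(x)=f_Lx^L+f_{L-1}x^{L-1}+\dots+f_1x+f_0\in\mathbb{Z}_{p^r}[x]$ is a linear recurrence relation of length $L$ for $S_0,\dots,S_{n-1}$ if $f_L$ is a unit and $f_LS_{L+j}+\sum_{i=1}^L f_{L-i}S_{L+j-i}=0$ for $j=0,\dots,n-L-1$. It is shortest if its length $L$ is minimal among all linear recurrence relations for $S_0,\dots,S_{n-1}$. Let $\mathcal{R}=\mathbb{Z}_{p^r}=\mathbb{Z}/p^r\mathbb{Z}$ and let $\mathrm{e}_1,\mathrm{e}_2$ be the unit vectors in $\mathcal{R}^2$. Monomials of $\mathcal{R}[x]^2$ are the elements $x^\alpha \mathrm{e}_i$ with $\alpha\in\mathbb{N}_0$, $i\in\{1,2\}$, ordered by the TOP (Term Over Position) order: $x^\alpha \mathrm{e}_i<x^\beta \mathrm{e}_j$ iff $\alpha<\beta$ or ($\alpha=\beta$ and $i>j$). Every nonzero $f\in\mathcal{R}[x]^2$ is uniquely $f=\sum_{i=1}^L c_iX_i$ with nonzero $c_i\in\mathcal{R}$ and monomials $X_1>\dots>X_L$. Put $\mathrm{lm}(f)=X_1$, $\mathrm{lt}(f)=c_1X_1$, $\mathrm{lc}(f)=c_1$; if $X_1=x^{\alpha}\mathrm{e}_{i}$, then $\mathrm{lpos}(f)=i$ and $\deg(f)=\alpha$. For a set $F$ of nonzero vectors, $\mathrm{L}(F)$ is the submodule generated by $\{\mathrm{lt}(f):f\in F\}$, and $\mathrm{L}(M)$ is the submodule generated by the leading terms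 of all nonzero elements of $M$. A finite set $G\subseteq M$ of nonzero vectors is a Gröbner basis of $M$ if $\mathrm{L}(G)=\mathrm{L}(M)$. A nonzero $f$ can be reduced modulo a set $F$ of nonzero vectors if there are $f_1,\dots,f_s\in F$ ($s\ge1$), $\alpha_i\in\mathbb{N}_0$ and $c_i\in\mathcal{R}$ with $\mathrm{lm}(f)=x^{\alpha_i}\mathrm{lm}(f_i)$ for all $i$ and $\mathrm{lt}(f)=\sum_{i=1}^s c_ix^{\alpha_i}\mathrm{lt}(f_i)$; otherwise $f$ is minimal with respect to $F$. A Gröbner basis $G$ is minimal if each $g\in G$ is minimal with respect to $G\setminus\{g\}$. The leading monomials of the elements of a minimal Gröbner basis are pairwise distinct. Order: an element $a\in\mathbb{Z}_{p^r}$ has order $k$ if the additive subgroup generated by $a$ has $p^k$ elements (units are the elements of order $r$); for nonzero $f\in\mathbb{Z}_{p^r}[x]^2$, $\mathrm{ord}(f)$ is the order of $\mathrm{lc}(f)$. Minimal TOP Gröbner $p$-basis of $M$: let $G=\{g_1,\dots,g_m\}$ be a minimal Gröbner basis of $M$ with respect to the TOP order, ordered so that $\mathrm{lm}(g_1)>\dots>\mathrm{lm}(g_m)$. For $1\le j\le m$ let $\beta_j:=\mathrm{ord}(g_j)-\mathrm{ord}(g_i)$, where $i$ is the smallest integer $>j$ with $\mathrm{lpos}(g_i)=\mathrm{lpos}(g_j)$; if no such $i$ exists, $\beta_j:=\mathrm{ord}(g_j)$. The sequence $(g_1,pg_1,\dots,p^{\beta_1-1}g_1,g_2,pg_2,\dots,p^{\beta_2-1}g_2,\dots,g_m,pg_m,\dots,p^{\beta_m-1}g_m)$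 is called a minimal TOP Gröbner $p$-basis of $M$. For the present $M$ it has $\beta_1+\dots+\beta_m=2r$ elements. $\mathcal{A}_p=\{0,1,\dots,p-1\}\subset\mathbb{Z}_{p^r}$, and $\mathcal{A}_p[x]$ is the set of polynomials in $\mathbb{Z}_{p^r}[x]$ with all coefficients in $\mathcal{A}_p$; $q_i=0$ is allowed for $i>\ell$. *)

theory Defs
  imports
    "Berlekamp_Zassenhaus.Finite_Field"
    "HOL-Computational_Algebra.Group_Closure"
    "HOL-Library.Product_Plus"
begin

text \<open>
  The ring of integers modulo \<open>p ^ r\<close> is the type \<open>'a mod_ring\<close> with \<open>CARD('a) = p ^ r\<close>.
  The free module of rank two over the polynomial ring is the product type \<open>'a poly \<times> 'a poly\<close>.
\<close>

definition vscale :: "'a::comm_ring_1 poly \<Rightarrow> 'a poly \<times> 'a poly \<Rightarrow> 'a poly \<times> 'a poly" where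
  "vscale q f = (q * fst f, q * snd f)"

interpretation R2: Modules.module "vscale :: 'a::comm_ring_1 poly \<Rightarrow> _"
  by unfold_locales (auto simp: vscale_def algebra_simps)


subsection \<open>Monomials and the TOP order\<close>

text \<open>The pair \<open>(\<alpha>, i)\<close> with \<open>i \<in> {1, 2}\<close> stands for the monomial \<open>x ^ \<alpha> e_i\<close>.\<close>

type_synonym mon = "nat \<times> nat"

definition mons :: "mon set" where
  "mons = UNIV \<times> {1, 2}"

definition mon_vec :: "mon \<Rightarrow> 'a::comm_ring_1 poly \<times> 'a poly" where
  "mon_vec X = (if snd X = 1 then (monom 1 (fst X), 0) else (0, monom 1 (fst X)))"

definition mon_times :: "nat \<Rightarrow> mon \<Rightarrow> mon" where
  "mon_times \<alpha> X = (\<alpha> + fst X, snd X)"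

definition top_less :: "mon \<Rightarrow> mon \<Rightarrow> bool" where
  "top_less X Y \<longleftrightarrow> fst X < fst Y \<or> (fst X = fst Y \<and> snd X > snd Y)"

definition vcoeff :: "'a::comm_ring_1 poly \<times> 'a poly \<Rightarrow> mon \<Rightarrow> 'a" where
  "vcoeff f X = (if snd X = 1 then coeff (fst f) (fst X) else coeff (snd f) (fst X))"

text \<open>The following notions are only meaningful for \<open>f \<noteq> 0\<close>.\<close>

definition lm :: "'a::comm_ring_1 poly \<times> 'a poly \<Rightarrow> mon" where
  "lm f = (THE X. X \<in> mons \<and> vcoeff f X \<noteq> 0 \<and>
             (\<forall>Y \<in> mons. vcoeff f Y \<noteq> 0 \<and> Y \<noteq> X \<longrightarrow> top_less Y X))"

definition lc :: "'a::comm_ring_1 poly \<times> 'a poly \<Rightarrow> 'a" where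
  "lc f = vcoeff f (lm f)"

definition lt :: "'a::comm_ring_1 poly \<times> 'a poly \<Rightarrow> 'a poly \<times> 'a poly" where
  "lt f = vscale [:lc f:] (mon_vec (lm f))"

definition lpos :: "'a::comm_ring_1 poly \<times> 'a poly \<Rightarrow> nat" where
  "lpos f = snd (lm f)"

definition vdeg :: "'a::comm_ring_1 poly \<times> 'a poly \<Rightarrow> nat" where
  "vdeg f = fst (lm f)"

lemma lm_ex1:
  fixes f :: "'a::comm_ring_1 poly \<times> 'a poly"
  assumes "f \<noteq> 0"
  shows "\<exists>!X. X \<in> mons \<and> vcoeff f X \<noteq> 0 \<and>
           (\<forall>Y \<in> mons. vcoeff f Y \<noteq> 0 \<and> Y \<noteq> X \<longrightarrow> top_less Y X)"
proof -
  have 1: "coeff p n = 0 \<or> n \<le> degree p" for p :: "'a poly" and n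
    using le_degree by blast
  have deg0: "degree p < n \<Longrightarrow> coeff p n = 0" for p :: "'a poly" and n
    by (rule coeff_eq_0)
  have 2: "coeff p (degree p) \<noteq> 0" if "p \<noteq> 0" for p :: "'a poly"
    using that by simp
  have ne: "fst f \<noteq> 0 \<or> snd f \<noteq> 0"
    using assms by (auto simp: prod_eq_iff)
  define X :: mon where "X =
    (if fst f \<noteq> 0 \<and> (snd f = 0 \<or> degree (snd f) \<le> degree (fst f))
     then (degree (fst f), 1) else (degree (snd f), 2))"
  have X: "X \<in> mons" "vcoeff f X \<noteq> 0"
    using ne 2 by (auto simp: X_def mons_def vcoeff_def)
  have dom: "top_less Y X" if "Y \<in> mons" "vcoeff f Y \<noteq> 0" "Y \<noteq> X" for Y
    using that 1[of "fst f" "fst Y"] 1[of "snd f" "fst Y"]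
    by (cases Y) (auto simp: X_def mons_def vcoeff_def top_less_def split: if_splits)
  have asym: "top_less Y Z \<Longrightarrow> \<not> top_less Z Y" for Y Z
    by (auto simp: top_less_def)
  show ?thesis
    using X dom asym by blast
qed


subsection \<open>Groebner bases\<close>

definition lead_module :: "('a::comm_ring_1 poly \<times> 'a poly) set \<Rightarrow> ('a poly \<times> 'a poly) set" where
  "lead_module F = R2.span (lt ` (F - {0}))"

definition groebner_basis ::
  "('a::comm_ring_1 poly \<times> 'a poly) set \<Rightarrow> ('a poly \<times> 'a poly) set \<Rightarrow> bool" where
  "groebner_basis M G \<longleftrightarrow> finite G \<and> G \<subseteq> M \<and> 0 \<notin> G \<and> lead_module G = lead_module M"

definition reducible_mod ::
  "('a::comm_ring_1 poly \<times> 'a poly) set \<Rightarrow> 'a poly \<times> 'a poly \<Rightarrow> bool" where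
  "reducible_mod F f \<longleftrightarrow>
     (\<exists>(s::nat) g \<alpha> c. 1 \<le> s \<and>
        (\<forall>i \<in> {1..s}. g i \<in> F \<and> lm f = mon_times (\<alpha> i) (lm (g i))) \<and>
        lt f = (\<Sum>i = 1..s. vscale (monom (c i) (\<alpha> i)) (lt (g i))))"

definition minimal_groebner_basis ::
  "('a::comm_ring_1 poly \<times> 'a poly) set \<Rightarrow> ('a poly \<times> 'a poly) set \<Rightarrow> bool" where
  "minimal_groebner_basis M G \<longleftrightarrow>
     groebner_basis M G \<and> (\<forall>g \<in> G. \<not> reducible_mod (G - {g}) g)"

definition add_ord :: "nat \<Rightarrow> 'a::comm_ring_1 \<Rightarrow> nat" where
  "add_ord p a = (THE k. card (group_closure {a}) = p ^ k)"

definition vord :: "nat \<Rightarrow> 'a::comm_ring_1 poly \<times> 'a poly \<Rightarrow> nat" where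
  "vord p f = add_ord p (lc f)"

text \<open>
  Lists are indexed from 0. The subtraction in \<open>gb_beta\<close> does not truncate for a minimal Groebner
  basis over the integers modulo \<open>p ^ r\<close> listed by decreasing leading monomials: otherwise the
  leading term of \<open>gs ! j\<close> would be a multiple of that of the later element.
\<close>

definition gb_beta :: "nat \<Rightarrow> ('a::comm_ring_1 poly \<times> 'a poly) list \<Rightarrow> nat \<Rightarrow> nat" where
  "gb_beta p gs j =
     (let P = (\<lambda>i. j < i \<and> i < length gs \<and> lpos (gs ! i) = lpos (gs ! j))
      in if \<exists>i. P i then vord p (gs ! j) - vord p (gs ! (LEAST i. P i))
         else vord p (gs ! j))"

definition p_expansion ::
  "nat \<Rightarrow> ('a::comm_ring_1 poly \<times> 'a poly) list \<Rightarrow> ('a poly \<times> 'a poly) list" where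
  "p_expansion p gs =
     concat (map (\<lambda>j. map (\<lambda>k. vscale (of_nat (p ^ k)) (gs ! j)) [0..<gb_beta p gs j])
                 [0..<length gs])"

definition minimal_groebner_p_basis ::
  "nat \<Rightarrow> ('a::comm_ring_1 poly \<times> 'a poly) set \<Rightarrow> ('a poly \<times> 'a poly) list \<Rightarrow> bool" where
  "minimal_groebner_p_basis p M vs \<longleftrightarrow>
     (\<exists>gs. minimal_groebner_basis M (set gs) \<and>
           sorted_wrt (\<lambda>g h. top_less (lm h) (lm g)) gs \<and>
           vs = p_expansion p gs)"


subsection \<open>Linear recurrence relations\<close>

text \<open>
  Only the entries \<open>S 0, \<dots>, S (n - 1)\<close> of \<open>S\<close> matter. The condition \<open>j + L < n\<close> is
  \<open>j \<le> n - L - 1\<close> over the integers, so the recurrence is vacuous for \<open>L \<ge> n\<close>.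
\<close>

definition lin_rec :: "nat \<Rightarrow> (nat \<Rightarrow> 'a::comm_ring_1) \<Rightarrow> nat \<Rightarrow> 'a poly \<Rightarrow> bool" where
  "lin_rec n S L f \<longleftrightarrow>
     degree f = L \<and> coeff f L dvd 1 \<and>
     (\<forall>j. j + L < n \<longrightarrow>
        coeff f L * S (L + j) + (\<Sum>i = 1..L. coeff f (L - i) * S (L + j - i)) = 0)"

definition shortest_lin_rec :: "nat \<Rightarrow> (nat \<Rightarrow> 'a::comm_ring_1) \<Rightarrow> 'a poly \<Rightarrow> bool" where
  "shortest_lin_rec n S f \<longleftrightarrow>
     (\<exists>L. lin_rec n S L f \<and> (\<forall>L' f'. lin_rec n S L' f' \<longrightarrow> L \<le> L'))"

definition seq_poly :: "nat \<Rightarrow> (nat \<Rightarrow> 'a::comm_ring_1) \<Rightarrow> 'a poly" where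
  "seq_poly n S = (\<Sum>i<n. monom (S i) (n - i))"

definition seq_module :: "nat \<Rightarrow> (nat \<Rightarrow> 'a::comm_ring_1) \<Rightarrow> ('a poly \<times> 'a poly) set" where
  "seq_module n S = R2.span {(1, - seq_poly n S), (0, monom 1 (n + 1))}"

definition digits :: "nat \<Rightarrow> 'a::comm_ring_1 set" where
  "digits p = of_nat ` {0..<p}"

definition digit_polys :: "nat \<Rightarrow> 'a::comm_ring_1 poly set" where
  "digit_polys p = {q. \<forall>k. coeff q k \<in> digits p}"

end

(*
  The product f S has no coefficients in degrees L < k <= n exactly if f is the first component of
  a vector in M all of whose monomials are at most x^L e_1. So a recurrence of length L is a vector
  of M with leading monomial x^L e_1 and unit leading coefficient. The leading term of such a vector
  is a combination of leading terms of the Groebner basis, and one of these has to be in position 1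
  with unit coefficient; minimality makes v_l the only candidate, whence the minimal length deg v_l.

  For the parametrization, the numbers beta_j are such that a nonzero vector w of M with leading
  coefficient of order s is divisible, on the level of leading monomials, by some v_i of order
  exactly s. Since the elements of Z/p^r annihilated by p are the digit multiples of any nonzero one
  among them, subtracting a digit times x^e v_i lowers the order of the leading coefficient.
  Iterating writes w as a combination of the v_i with digit polynomials as coefficients and all
  summands bounded by the leading monomial of w. Among the v_i with i >= l only v_l contributes a
  unit to the coefficient of x^L e_1, all other contributions being divisible by p.
*)
theory Submission
  imports Defs
begin

subsection \<open>Additive orders modulo a prime power\<close>

lemma digitsI: "k < p \<Longrightarrow> of_nat k \<in> digits p"
  by (auto simp: digits_def)

locale mod_prime_power =
  fixes p r :: nat and ty :: "'a::nontriv itself"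
  assumes p: "prime p" and r: "1 \<le> r" and card: "CARD('a) = p ^ r"
begin

lemma of_int_eq_0_iff: "(of_int z :: 'a mod_ring) = 0 \<longleftrightarrow> int p ^ r dvd z"
proof -
  have "(of_int z :: 'a mod_ring) = 0 \<longleftrightarrow> z mod int CARD('a) = 0"
    unfolding of_int_of_int_mod_ring by transfer simp
  then show ?thesis
    by (simp add: card dvd_eq_mod_eq_0)
qed

lemma of_int_cases:
  fixes a :: "'a mod_ring"
  obtains z where "a = of_int z"
  by (metis of_int_mod_ring_to_int_mod_ring of_int_of_int_mod_ring)

lemma p_power_r_times: "of_nat (p ^ r) * (a :: 'a mod_ring) = 0"
proof -
  have "(of_nat (p ^ r) :: 'a mod_ring) = 0"
    using of_nat_card_eq_0[where ?'a = 'a] by (simp only: card)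
  then show ?thesis by (simp only: mult_zero_left)
qed

text \<open>After lifting \<open>a\<close> to an integer \<open>z\<close>, both sides say that p
  does not divide \<open>z\<close>; Bezout provides the inverse. The right-hand side ignores
  summands killed by p^(r-1), so adding such a summand to a unit leaves a unit.\<close>

lemma dvd_one_iff: "(a :: 'a mod_ring) dvd 1 \<longleftrightarrow> of_nat (p ^ (r - 1)) * a \<noteq> 0"
proof -
  obtain z where z: "a = of_int z" by (rule of_int_cases)
  have pr: "int p ^ r = int p ^ (r - 1) * int p"
    using r by (cases r) auto
  have "of_nat (p ^ (r - 1)) * a = of_int (int p ^ (r - 1) * z)"
    by (simp add: z)
  then have 1: "of_nat (p ^ (r - 1)) * a = 0 \<longleftrightarrow> int p dvd z"
    using p by (simp only: of_int_eq_0_iff pr) (simp add: prime_gt_0_nat)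
  show ?thesis
  proof
    assume "a dvd 1"
    then obtain b where b: "a * b = 1" by (metis dvdE)
    obtain y where y: "b = of_int y" by (rule of_int_cases)
    have "of_int (z * y - 1) = (0 :: 'a mod_ring)"
      using b by (simp add: z y)
    then have "int p ^ r dvd z * y - 1" by (simp only: of_int_eq_0_iff)
    then have "int p dvd z * y - 1" by (simp only: pr) (metis dvd_mult_right)
    then have "\<not> int p dvd z"
      by (metis dvd_diff_right_iff dvd_mult2 not_prime_unit p prime_nat_int_transfer)
    with 1 show "of_nat (p ^ (r - 1)) * a \<noteq> 0" by blast
  next
    assume "of_nat (p ^ (r - 1)) * a \<noteq> 0"
    with 1 have "\<not> int p dvd z" by blast
    with p have "coprime (int p) z" by (simp add: prime_imp_coprime)
    then have "coprime z (int p ^ r)" by (simp add: coprime_commute)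
    then obtain u w where "u * z + w * int p ^ r = 1"
      by (metis bezout_int coprime_imp_gcd_eq_1)
    then have "int p ^ r dvd u * z - 1"
      by (metis add_diff_cancel_left' diff_add_eq_diff_diff_swap dvd_minus_iff dvd_triv_right minus_diff_eq diff_diff_eq2)
    then have "of_int (u * z - 1) = (0 :: 'a mod_ring)" by (simp only: of_int_eq_0_iff)
    then have "1 = a * of_int u" by (simp add: z mult.commute)
    then show "a dvd 1" by (rule dvdI)
  qed
qed

text \<open>A representative k with 0 < k < p is prime to p.\<close>

lemma nonzero_digit_dvd_one:
  assumes "(c :: 'a mod_ring) \<in> digits p" "c \<noteq> 0"
  shows "c dvd 1"
proof -
  obtain k where k: "k < p" "c = of_nat k"
    using assms(1) by (auto simp: digits_def)
  have "\<not> int p ^ r dvd int p ^ (r - 1) * int k"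
  proof
    assume "int p ^ r dvd int p ^ (r - 1) * int k"
    moreover have "int p ^ r = int p ^ (r - 1) * int p"
      using r by (cases r) auto
    ultimately have "int p dvd int k" using p by (simp add: prime_gt_0_nat)
    then have "k = 0" using k(1) by (metis dvd_imp_le int_dvd_int_iff not_le gr0I)
    with assms(2) k(2) show False by simp
  qed
  then have "of_int (int p ^ (r - 1) * int k) \<noteq> (0 :: 'a mod_ring)"
    by (simp only: of_int_eq_0_iff not_False_eq_True)
  then show ?thesis by (simp add: dvd_one_iff k(2))
qed

text \<open>The elements killed by p are the multiples of p^(r-1). They form a line over the field
  with p elements, spanned by any nonzero \<open>y\<close>, and the digits represent the
  scalars.\<close>

lemma p_torsion_digit_multiple:
  fixes x y :: "'a mod_ring"
  assumes "of_nat p * x = 0" "of_nat p * y = 0" "y \<noteq> 0"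
  obtains c where "c \<in> digits p" "x = c * y"
proof -
  have pr: "int p ^ r = int p * int p ^ (r - 1)"
    using r by (cases r) auto
  have *: "\<exists>z. a = of_int (int p ^ (r - 1) * z)" if "of_nat p * a = 0" for a :: "'a mod_ring"
  proof -
    obtain z where z: "a = of_int z" by (rule of_int_cases)
    have "of_int (int p * z) = (0 :: 'a mod_ring)" using that by (simp add: z)
    then have "int p ^ (r - 1) dvd z"
      using p by (simp only: of_int_eq_0_iff pr) (simp add: prime_gt_0_nat)
    then show ?thesis using z by (auto elim!: dvdE)
  qed
  obtain a b where ab: "x = of_int (int p ^ (r - 1) * a)" "y = of_int (int p ^ (r - 1) * b)"
    using *[OF assms(1)] *[OF assms(2)] by blast
  have "\<not> int p dvd b"
  proof
    assume "int p dvd b"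
    then have "int p ^ r dvd int p ^ (r - 1) * b"
      by (simp add: pr mult.commute mult_dvd_mono)
    then have "y = 0" by (simp only: ab of_int_eq_0_iff)
    with assms(3) show False by blast
  qed
  with p have "coprime b (int p)"
    by (metis coprime_commute prime_imp_coprime prime_nat_int_transfer)
  then obtain u w where uw: "u * b + w * int p = 1"
    by (metis bezout_int coprime_imp_gcd_eq_1)
  \<comment> \<open>\<open>u\<close> inverts \<open>b\<close> modulo p, so \<open>k\<close> is the
    digit of the quotient a / b modulo p.\<close>
  define k where "k = nat ((a * u) mod int p)"
  have p0: "int p > 0" using p by (simp add: prime_gt_0_nat)
  have k: "k < p" "int k = (a * u) mod int p"
    using p0 by (auto simp: k_def nat_less_iff)
  have "int p dvd a - a * u * b"
  proof -
    have "a - a * u * b = int p * (a * w)"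
      using arg_cong[OF uw, of "\<lambda>t. a * t"] by (simp add: algebra_simps)
    then show ?thesis by simp
  qed
  moreover have "int p dvd a * u * b - int k * b"
  proof -
    have "int p dvd (a * u - int k) * b" unfolding k by (simp add: minus_mod_eq_mult_div)
    then show ?thesis by (simp add: algebra_simps)
  qed
  ultimately have "int p dvd (a - a * u * b) + (a * u * b - int k * b)"
    by (rule dvd_add)
  then have "int p dvd a - int k * b" by simp
  then have "int p ^ r dvd int p ^ (r - 1) * (a - int k * b)"
    by (simp add: pr mult.commute mult_dvd_mono)
  then have "of_int (int p ^ (r - 1) * (a - int k * b)) = (0 :: 'a mod_ring)"
    by (simp only: of_int_eq_0_iff)
  then have "x = of_nat k * y"
    by (simp add: ab algebra_simps)
  with that[OF digitsI[OF k(1)]] show thesis by blast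
qed

lemma group_closure_singleton: "group_closure {a :: 'a mod_ring} = range (\<lambda>z. of_int z * a)"
proof (intro equalityI subsetI)
  fix b assume "b \<in> group_closure {a}"
  then show "b \<in> range (\<lambda>z. of_int z * a)"
  proof induction
    case (base s)
    then show ?case
      by (auto intro: range_eqI[of _ _ 0] range_eqI[of _ _ 1])
  next
    case (diff s t)
    then show ?case
      by (auto simp flip: left_diff_distrib of_int_diff)
  qed
next
  fix b assume "b \<in> range (\<lambda>z. of_int z * a)"
  then obtain z where "b = of_int z * a" by blast
  moreover have "of_int z * a \<in> group_closure {a}"
    using group_closure_scalar_mult_left[of a "{a}" "nat \<bar>z\<bar>"] group_closure.base[of a "{a}"]
    by (cases "z \<ge> 0") auto
  ultimately show "b \<in> group_closure {a}" by simp
qed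

text \<open>Replaces the definite description over cardinalities by annihilation. The integers
  killing \<open>a\<close> are the multiples of p^k for the least exponent k, hence the subgroup has
  p^k elements.\<close>

lemma add_ord_le_iff: "add_ord p (a :: 'a mod_ring) \<le> t \<longleftrightarrow> of_nat (p ^ t) * a = 0"
proof -
  define k where "k = (LEAST t. of_nat (p ^ t) * a = 0)"
  have k: "of_nat (p ^ k) * a = 0"
    unfolding k_def by (rule LeastI[of _ r]) (rule p_power_r_times)
  have least: "k \<le> t" if "of_nat (p ^ t) * a = 0" for t
    unfolding k_def by (rule Least_le) (rule that)
  have ann: "of_int z * a = 0 \<longleftrightarrow> int p ^ k dvd z" for z
  proof
    assume z: "of_int z * a = 0"
    \<comment> \<open>As a Bezout combination the gcd also kills \<open>a\<close>. Dividing p^k, it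
      is some p^i, and leastness of k forces i = k.\<close>
    obtain u w where uw: "u * z + w * int p ^ k = gcd z (int p ^ k)"
      by (metis bezout_int)
    have "gcd z (int p ^ k) dvd int p ^ k" by simp
    moreover have "prime (int p)" using p by simp
    ultimately obtain i where i: "i \<le> k" "gcd z (int p ^ k) = int p ^ i"
      by (metis divides_primepow normalize_gcd normalize_power of_nat_0_le_iff zabs_def
          normalize_int_def abs_of_nat of_nat_power abs_gcd_int)
    have "of_int (u * z + w * int p ^ k) * a = of_int u * (of_int z * a) + of_int w * (of_nat (p ^ k) * a)"
      by (simp add: algebra_simps)
    also have "\<dots> = 0" by (simp only: z k mult_zero_right add_0)
    finally have "of_nat (p ^ i) * a = 0" by (simp add: uw i(2))
    with least i(1) have "i = k" by force
    with i(2) show "int p ^ k dvd z" by (metis gcd_dvd1)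
  next
    assume "int p ^ k dvd z"
    then obtain y where "z = int p ^ k * y" by (rule dvdE)
    then have "of_int z * a = of_int y * (of_nat (p ^ k) * a)" by (simp add: algebra_simps)
    then show "of_int z * a = 0" by (simp only: k mult_zero_right)
  qed
  have eq: "of_int y * a = of_int z * a \<longleftrightarrow> y mod int p ^ k = z mod int p ^ k" for y z
    using ann[of "y - z"] by (simp add: algebra_simps mod_eq_dvd_iff)
  have p0: "0 < int p ^ k" using p by (simp add: prime_gt_0_nat)
  have "bij_betw (\<lambda>z. of_int z * a) {0..<int p ^ k} (group_closure {a})"
    unfolding bij_betw_def group_closure_singleton
  proof
    show "inj_on (\<lambda>z. of_int z * a) {0..<int p ^ k}"
      by (rule inj_onI) (simp add: eq)
    show "(\<lambda>z. of_int z * a) ` {0..<int p ^ k} = range (\<lambda>z. of_int z * a)"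
    proof (intro equalityI subsetI)
      fix b assume "b \<in> range (\<lambda>z. of_int z * a)"
      then obtain z where "b = of_int z * a" by blast
      then have "b = of_int (z mod int p ^ k) * a" by (simp add: eq)
      moreover have "z mod int p ^ k \<in> {0..<int p ^ k}" using p0 by simp
      ultimately show "b \<in> (\<lambda>z. of_int z * a) ` {0..<int p ^ k}" by blast
    qed auto
  qed
  then have "card (group_closure {a}) = p ^ k"
    using bij_betw_same_card by (fastforce simp: nat_power_eq)
  then have "add_ord p a = k"
    unfolding add_ord_def using prime_gt_1_nat[OF p] by (intro the_equality) auto
  moreover have "of_nat (p ^ t) * a = 0" if "k \<le> t"
    using ann[of "int p ^ t"] that by (simp add: le_imp_power_dvd)
  ultimately show ?thesis using least by blast
qed

lemma add_ord_le: "add_ord p (a :: 'a mod_ring) \<le> r"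
  by (simp only: add_ord_le_iff p_power_r_times)

lemma add_ord_eq_0_iff: "add_ord p (a :: 'a mod_ring) = 0 \<longleftrightarrow> a = 0"
  using add_ord_le_iff[of a 0] by simp

text \<open>Both numbers have the same upper bounds. Truncation is correct here: for k beyond the
  order the product is 0, which has order 0.\<close>

lemma add_ord_p_power_times:
  "add_ord p (of_nat (p ^ k) * (a :: 'a mod_ring)) = add_ord p a - k"
proof -
  have "add_ord p (of_nat (p ^ k) * a) \<le> t \<longleftrightarrow> add_ord p a - k \<le> t" for t
    using add_ord_le_iff[of a "t + k"] add_ord_le_iff[of "of_nat (p ^ k) * a" t]
    by (simp add: power_add mult.assoc le_diff_conv)
  then show ?thesis by (meson eq_iff)
qed

lemma add_ord_eq_r_iff: "add_ord p (a :: 'a mod_ring) = r \<longleftrightarrow> a dvd 1"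
  using add_ord_le_iff[of a "r - 1"] add_ord_le[of a] r dvd_one_iff[of a] by auto

end

subsection \<open>Ranks of monomials\<close>

text \<open>The rank is \<open>2 * \<alpha> + 1\<close> for \<open>x ^ \<alpha> e_1\<close> and \<open>2 * \<alpha>\<close> for \<open>x ^ \<alpha> e_2\<close>. It identifies the TOP order
  with the order of the natural numbers, and multiplication by \<open>x ^ e\<close> adds \<open>2 * e\<close>.\<close>

definition mon_rank :: "mon \<Rightarrow> nat" where
  "mon_rank X = 2 * fst X + (2 - snd X)"

definition rcoeff :: "'a::comm_ring_1 poly \<times> 'a poly \<Rightarrow> nat \<Rightarrow> 'a" where
  "rcoeff w m = coeff (if odd m then fst w else snd w) (m div 2)"

definition lrank :: "'a::comm_ring_1 poly \<times> 'a poly \<Rightarrow> nat" where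
  "lrank w = mon_rank (lm w)"

lemma monsE:
  assumes "X \<in> mons"
  obtains \<alpha> where "X = (\<alpha>, 1)" | \<alpha> where "X = (\<alpha>, 2)"
  using assms by (auto simp: mons_def)

lemma mon_rank_inject: "X \<in> mons \<Longrightarrow> Y \<in> mons \<Longrightarrow> mon_rank X = mon_rank Y \<longleftrightarrow> X = Y"
  by (erule monsE; erule monsE) (auto simp: mon_rank_def, presburger+)

lemma top_less_iff_mon_rank:
  "X \<in> mons \<Longrightarrow> Y \<in> mons \<Longrightarrow> top_less X Y \<longleftrightarrow> mon_rank X < mon_rank Y"
  by (erule monsE; erule monsE) (auto simp: mon_rank_def top_less_def)

lemma snd_eq_1_iff: "X \<in> mons \<Longrightarrow> snd X = 1 \<longleftrightarrow> odd (mon_rank X)"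
  by (erule monsE) (auto simp: mon_rank_def)

lemma fst_eq_mon_rank: "X \<in> mons \<Longrightarrow> fst X = mon_rank X div 2"
  by (erule monsE) (auto simp: mon_rank_def)

lemma snd_eq_iff:
  "X \<in> mons \<Longrightarrow> Y \<in> mons \<Longrightarrow> snd X = snd Y \<longleftrightarrow> (even (mon_rank X) \<longleftrightarrow> even (mon_rank Y))"
  by (erule monsE; erule monsE) (auto simp: mon_rank_def)

lemma mon_rank_times: "mon_rank (mon_times e X) = 2 * e + mon_rank X"
  by (simp add: mon_rank_def mon_times_def)

lemma rcoeff_mon_rank: "X \<in> mons \<Longrightarrow> rcoeff w (mon_rank X) = vcoeff w X"
  by (erule monsE) (auto simp: rcoeff_def mon_rank_def vcoeff_def)

lemma mon_rank_surj: obtains X where "X \<in> mons" "mon_rank X = m"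
proof (cases "odd m")
  case True
  then show thesis
    by (intro that[of "(m div 2, 1)"]) (auto simp: mons_def mon_rank_def)
next
  case False
  then show thesis
    by (intro that[of "(m div 2, 2)"]) (auto simp: mons_def mon_rank_def)
qed

section \<open>Vector arithmetic on coefficients indexed by rank\<close>

lemma rcoeff_eqI: "(\<And>m. rcoeff u m = rcoeff w m) \<Longrightarrow> u = w"
proof -
  assume *: "\<And>m. rcoeff u m = rcoeff w m"
  have "coeff (fst u) k = coeff (fst w) k" "coeff (snd u) k = coeff (snd w) k" for k
    using *[of "2 * k + 1"] *[of "2 * k"] by (simp_all add: rcoeff_def)
  then show ?thesis by (simp add: prod_eq_iff poly_eq_iff)
qed

lemma rcoeff_0 [simp]: "rcoeff 0 m = 0"
  by (simp add: rcoeff_def)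

lemma rcoeff_add: "rcoeff (u + w) m = rcoeff u m + rcoeff w m"
  by (simp add: rcoeff_def)

lemma rcoeff_diff: "rcoeff (u - w) m = rcoeff u m - rcoeff w m"
  by (simp add: rcoeff_def)

text \<open>Multiplication by x^i raises ranks by 2 * i and keeps parity, so the convolution stays
  within one component.\<close>

lemma rcoeff_vscale:
  "rcoeff (vscale q w) m = (\<Sum>i\<le>m div 2. coeff q i * rcoeff w (m - 2 * i))"
proof -
  have "(m - 2 * i) div 2 = m div 2 - i" "odd (m - 2 * i) \<longleftrightarrow> odd m" if "i \<le> m div 2" for i
    using that by (auto simp: even_diff_nat)
  then show ?thesis
    by (auto simp: rcoeff_def vscale_def coeff_mult intro!: sum.cong)
qed

lemma rcoeff_vscale_monom:
  "rcoeff (vscale (monom c e) w) m = (if 2 * e \<le> m then c * rcoeff w (m - 2 * e) else 0)"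
proof -
  have "rcoeff (vscale (monom c e) w) m =
    (\<Sum>i\<le>m div 2. if e = i then c * rcoeff w (m - 2 * e) else 0)"
    unfolding rcoeff_vscale by (rule sum.cong) (auto simp: coeff_monom)
  then show ?thesis by (auto simp: sum.delta)
qed

lemma rcoeff_vscale_of_nat: "rcoeff (vscale (of_nat c) w) m = of_nat c * rcoeff w m"
  using rcoeff_vscale_monom[of "of_nat c" 0 w m] by (simp add: of_nat_poly monom_0)

text \<open>The description defining \<open>lm\<close> is unfolded here once; later facts about
  leading data rest on these four.\<close>

lemma lm_rcoeff:
  fixes w :: "'a::comm_ring_1 poly \<times> 'a poly"
  assumes "w \<noteq> 0"
  shows "lm w \<in> mons" "rcoeff w (lrank w) = lc w" "lc w \<noteq> 0"
    and "lrank w < m \<Longrightarrow> rcoeff w m = 0"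
proof -
  have *: "lm w \<in> mons \<and> vcoeff w (lm w) \<noteq> 0 \<and>
      (\<forall>Y \<in> mons. vcoeff w Y \<noteq> 0 \<and> Y \<noteq> lm w \<longrightarrow> top_less Y (lm w))"
    unfolding lm_def by (rule theI') (rule lm_ex1[OF assms])
  then show "lm w \<in> mons" "rcoeff w (lrank w) = lc w" "lc w \<noteq> 0"
    by (auto simp: lc_def lrank_def rcoeff_mon_rank)
  show "rcoeff w m = 0" if m: "lrank w < m"
  proof -
    obtain X where X: "X \<in> mons" "mon_rank X = m" by (rule mon_rank_surj)
    have "vcoeff w X = 0"
    proof (rule ccontr)
      assume "vcoeff w X \<noteq> 0"
      moreover have "X \<noteq> lm w" using X m by (auto simp: lrank_def)
      ultimately have "top_less X (lm w)" using * X by blast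
      then show False using X m * by (simp add: top_less_iff_mon_rank lrank_def)
    qed
    then show ?thesis using X by (simp flip: rcoeff_mon_rank)
  qed
qed

lemma lrank_eqI:
  assumes "rcoeff w m \<noteq> 0" "\<And>m'. m < m' \<Longrightarrow> rcoeff w m' = 0"
  shows "w \<noteq> 0" "lrank w = m"
proof -
  show "w \<noteq> 0" using assms(1) by auto
  then show "lrank w = m"
    using assms lm_rcoeff(2-4)[of w] by (metis linorder_neqE_nat)
qed

lemma lpos_eq_1_iff: "w \<noteq> 0 \<Longrightarrow> lpos w = 1 \<longleftrightarrow> odd (lrank w)"
  unfolding lpos_def lrank_def by (rule snd_eq_1_iff) (rule lm_rcoeff)

lemma lpos_eq_iff:
  "u \<noteq> 0 \<Longrightarrow> w \<noteq> 0 \<Longrightarrow> lpos u = lpos w \<longleftrightarrow> (even (lrank u) \<longleftrightarrow> even (lrank w))"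
  unfolding lpos_def lrank_def by (intro snd_eq_iff lm_rcoeff)

lemma vdeg_eq: "w \<noteq> 0 \<Longrightarrow> vdeg w = lrank w div 2"
  unfolding vdeg_def lrank_def by (rule fst_eq_mon_rank) (rule lm_rcoeff)

lemma rcoeff_lt:
  assumes "w \<noteq> 0"
  shows "rcoeff (lt w) m = (if m = lrank w then lc w else 0)"
proof -
  have "rcoeff (mon_vec (lm w) :: 'a poly \<times> 'a poly) m = (if m = lrank w then 1 else 0)"
    using lm_rcoeff(1)[OF assms]
    by (rule monsE) (auto simp: rcoeff_def mon_vec_def lrank_def mon_rank_def coeff_monom)
  then show ?thesis
    using rcoeff_vscale_monom[of "lc w" 0 "mon_vec (lm w)" m] by (simp add: lt_def monom_0)
qed

lemma lc_vscale:
  assumes "w \<noteq> 0" "of_nat c * lc w \<noteq> 0"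
  shows "vscale (of_nat c) w \<noteq> 0" "lrank (vscale (of_nat c) w) = lrank w"
    "lm (vscale (of_nat c) w) = lm w" "lc (vscale (of_nat c) w) = of_nat c * lc w"
proof -
  have 1: "rcoeff (vscale (of_nat c) w) (lrank w) = of_nat c * lc w"
    using lm_rcoeff[OF assms(1)] by (simp add: rcoeff_vscale_of_nat)
  have 2: "rcoeff (vscale (of_nat c) w) m = 0" if "lrank w < m" for m
    using lm_rcoeff[OF assms(1)] that by (simp add: rcoeff_vscale_of_nat)
  show *: "vscale (of_nat c) w \<noteq> 0" "lrank (vscale (of_nat c) w) = lrank w"
    using lrank_eqI[of "vscale (of_nat c) w" "lrank w"] 1 2 assms(2) by auto
  show "lm (vscale (of_nat c) w) = lm w"
    using *(2) mon_rank_inject lm_rcoeff(1)[OF *(1)] lm_rcoeff(1)[OF assms(1)]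
    unfolding lrank_def by blast
  show "lc (vscale (of_nat c) w) = of_nat c * lc w"
    using 1 * lm_rcoeff(2)[OF *(1)] by simp
qed

lemma rcoeff_vscale_above:
  assumes "\<And>m. b < m \<Longrightarrow> rcoeff w m = 0"
    and "\<And>e. coeff q e \<noteq> 0 \<Longrightarrow> 2 * e + b \<le> N" and "N < m"
  shows "rcoeff (vscale q w) m = 0"
  unfolding rcoeff_vscale
proof (rule sum.neutral, rule ballI)
  fix i assume "i \<in> {..m div 2}"
  then show "coeff q i * rcoeff w (m - 2 * i) = 0"
    using assms(1)[of "m - 2 * i"] assms(2)[of i] assms(3)
    by (cases "coeff q i = 0") auto
qed

text \<open>The bound on \<open>q\<close> lets only the rank \<open>b\<close> of \<open>w\<close>
  contribute at rank \<open>N\<close>, and \<open>a\<close> kills that coefficient. Since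
  \<open>b\<close> is merely an upper bound, it may be odd even for a vector with leading position
  2.\<close>

lemma rcoeff_vscale_top:
  assumes "\<And>m. b < m \<Longrightarrow> rcoeff w m = 0"
    and "\<And>e. coeff q e \<noteq> 0 \<Longrightarrow> 2 * e + b \<le> N" and "a * rcoeff w b = 0"
  shows "a * rcoeff (vscale q w) N = 0"
  unfolding rcoeff_vscale sum_distrib_left
proof (rule sum.neutral, rule ballI)
  fix i assume "i \<in> {..N div 2}"
  then have "rcoeff w (N - 2 * i) = 0 \<or> N - 2 * i = b" if "coeff q i \<noteq> 0"
    using assms(1)[of "N - 2 * i"] assms(2)[OF that] by (metis le_neq_implies_less add_le_imp_le_diff add.commute)
  then show "a * (coeff q i * rcoeff w (N - 2 * i)) = 0"
    using assms(3) by (metis mult.left_commute mult_zero_left mult_zero_right)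
qed

lemma rcoeff_sum: "rcoeff (\<Sum>i\<in>I. f i) m = (\<Sum>i\<in>I. rcoeff (f i) m)"
  by (induction I rule: infinite_finite_induct) (simp_all add: rcoeff_add)

section \<open>The p-expansion as a list of blocks\<close>

lemma set_p_expansion:
  "w \<in> set (p_expansion p gs) \<longleftrightarrow>
    (\<exists>j < length gs. \<exists>k < gb_beta p gs j. w = vscale (of_nat (p ^ k)) (gs ! j))"
  by (simp add: p_expansion_def) fastforce

lemma sorted_wrt_concat_upt:
  assumes "\<And>j. j < n \<Longrightarrow> sorted_wrt P (F j)"
    and "\<And>i j x y. i < j \<Longrightarrow> j < n \<Longrightarrow> x \<in> set (F i) \<Longrightarrow> y \<in> set (F j) \<Longrightarrow> P x y"
  shows "sorted_wrt P (concat (map F [0..<n]))"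
  using assms by (induction n) (auto simp: sorted_wrt_append)

text \<open>Keeps every multiple p^k g_j of a block nonzero.\<close>

lemma gb_beta_le: "gb_beta p gs j \<le> vord p (gs ! j)"
  by (simp add: gb_beta_def Let_def)

subsection \<open>Minimal Groebner p-bases over the integers modulo a prime power\<close>

locale groebner_p_basis = mod_prime_power p r ty
  for p r :: nat and ty :: "'a::nontriv itself" +
  fixes M :: "('a mod_ring poly \<times> 'a mod_ring poly) set"
    and gs :: "('a mod_ring poly \<times> 'a mod_ring poly) list"
  assumes M: "R2.subspace M"
    and gb: "minimal_groebner_basis M (set gs)"
    and sorted: "sorted_wrt (\<lambda>g h. top_less (lm h) (lm g)) gs"
begin

lemma gs_nonzero: "g \<in> set gs \<Longrightarrow> g \<noteq> 0"
  using gb unfolding minimal_groebner_basis_def groebner_basis_def by blast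

lemma gs_in_M: "g \<in> set gs \<Longrightarrow> g \<in> M"
  using gb unfolding minimal_groebner_basis_def groebner_basis_def by blast

lemma lrank_decreasing: "i < j \<Longrightarrow> j < length gs \<Longrightarrow> lrank (gs ! j) < lrank (gs ! i)"
proof -
  assume ij: "i < j" "j < length gs"
  then have "gs ! i \<noteq> 0" "gs ! j \<noteq> 0" by (auto intro!: gs_nonzero)
  moreover have "top_less (lm (gs ! j)) (lm (gs ! i))"
    using sorted ij by (simp add: sorted_wrt_iff_nth_less)
  ultimately show ?thesis by (simp add: lrank_def top_less_iff_mon_rank lm_rcoeff(1))
qed

lemma vord_pos: "w \<noteq> 0 \<Longrightarrow> 0 < vord p (w :: 'a mod_ring poly \<times> _)"
  using lm_rcoeff(3)[of w] add_ord_eq_0_iff[of "lc w"] by (simp add: vord_def)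

text \<open>Otherwise the leading terms of the basis all lie in a submodule that excludes
  \<open>lt w\<close>, against the equality of the two leading modules.\<close>

lemma ex_divisor:
  assumes "w \<in> M" "w \<noteq> 0"
  shows "\<exists>g \<in> set gs. \<exists>e. lrank w = 2 * e + lrank g \<and> vord p w \<le> vord p g"
proof (rule ccontr)
  assume contra: "\<not> ?thesis"
  define t where "t = vord p w - 1"
  \<comment> \<open>The ranks \<open>lrank w - 2 * e\<close> belong to the monomials dividing
    \<open>lm w\<close>. The exponent \<open>t\<close> is one short of the order of
    \<open>lc w\<close>, so \<open>lt w\<close> is not in \<open>U\<close>.\<close>
  define U where "U = {u :: 'a mod_ring poly \<times> 'a mod_ring poly.
    \<forall>e. 2 * e \<le> lrank w \<longrightarrow> of_nat (p ^ t) * rcoeff u (lrank w - 2 * e) = 0}"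
  have "R2.subspace U"
  proof (rule R2.subspaceI)
    fix c :: "'a mod_ring poly" and u assume u: "u \<in> U"
    have "of_nat (p ^ t) * rcoeff (vscale c u) (lrank w - 2 * e) = 0" if e: "2 * e \<le> lrank w" for e
      unfolding rcoeff_vscale sum_distrib_left
    proof (rule sum.neutral, rule ballI)
      fix i assume "i \<in> {..(lrank w - 2 * e) div 2}"
      then have "2 * (e + i) \<le> lrank w" using e by auto
      then have "of_nat (p ^ t) * rcoeff u (lrank w - 2 * (e + i)) = 0"
        using u unfolding U_def by blast
      then show "of_nat (p ^ t) * (coeff c i * rcoeff u (lrank w - 2 * e - 2 * i)) = 0"
        by (metis (no_types) add_mult_distrib2 diff_diff_left mult.left_commute mult_zero_right)
    qed
    then show "vscale c u \<in> U" by (simp add: U_def del: of_nat_power)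
  qed (auto simp: U_def rcoeff_add distrib_left simp del: of_nat_power)
  moreover have "lt ` (set gs - {0}) \<subseteq> U"
  proof (rule image_subsetI)
    fix g assume "g \<in> set gs - {0}"
    then have g: "g \<in> set gs" "g \<noteq> 0" by auto
    have "of_nat (p ^ t) * lc g = 0" if "2 * e \<le> lrank w" "lrank w - 2 * e = lrank g" for e
    proof -
      have "lrank w = 2 * e + lrank g" using that by simp
      with contra g(1) have "\<not> vord p w \<le> vord p g" by blast
      then have "vord p g \<le> t" by (simp add: t_def)
      then show ?thesis by (simp only: vord_def add_ord_le_iff)
    qed
    then show "lt g \<in> U" by (auto simp: U_def rcoeff_lt[OF g(2)] simp del: of_nat_power)
  qed
  ultimately have "lead_module (set gs) \<subseteq> U"
    unfolding lead_module_def by (intro R2.span_minimal)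
  moreover have "lt w \<in> lead_module M"
    unfolding lead_module_def using assms by (intro R2.span_base) auto
  moreover have "lead_module (set gs) = lead_module M"
    using gb unfolding minimal_groebner_basis_def groebner_basis_def by blast
  ultimately have "lt w \<in> U" by blast
  then have "of_nat (p ^ t) * lc w = 0"
    unfolding U_def using rcoeff_lt[OF assms(2), of "lrank w"] by (auto dest!: spec[of _ 0])
  then have "vord p w \<le> t" by (simp only: vord_def add_ord_le_iff)
  with vord_pos[OF assms(2)] show False by (simp add: t_def)
qed

lemma p_power_multiple:
  assumes "g \<noteq> 0" "k < vord p g"
  shows "vscale (of_nat (p ^ k)) g \<noteq> 0" "lrank (vscale (of_nat (p ^ k)) g) = lrank g"
    "lm (vscale (of_nat (p ^ k)) g) = lm g"
    "vord p (vscale (of_nat (p ^ k)) (g :: 'a mod_ring poly \<times> _)) = vord p g - k"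
proof -
  have nz: "of_nat (p ^ k) * lc g \<noteq> 0"
    using assms(2) add_ord_le_iff[of "lc g" k] by (simp add: vord_def del: of_nat_power)
  show "vscale (of_nat (p ^ k)) g \<noteq> 0" "lrank (vscale (of_nat (p ^ k)) g) = lrank g"
    "lm (vscale (of_nat (p ^ k)) g) = lm g"
    by (rule lc_vscale[OF assms(1) nz])+
  show "vord p (vscale (of_nat (p ^ k)) g) = vord p g - k"
    by (simp only: vord_def lc_vscale[OF assms(1) nz] add_ord_p_power_times)
qed

lemma p_expansion_cases:
  assumes "v \<in> set (p_expansion p gs)"
  obtains g k where "g \<in> set gs" "k < vord p g" "v = vscale (of_nat (p ^ k)) g"
proof -
  obtain j k where jk: "j < length gs" "k < gb_beta p gs j" "v = vscale (of_nat (p ^ k)) (gs ! j)"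
    using assms unfolding set_p_expansion by blast
  with gb_beta_le[of p gs j] that[of "gs ! j" k] show thesis by simp
qed

lemma p_expansion_nonzero: "v \<in> set (p_expansion p gs) \<Longrightarrow> v \<noteq> 0"
  using gs_nonzero p_power_multiple(1) by (metis p_expansion_cases)

lemma p_expansion_in_M: "v \<in> set (p_expansion p gs) \<Longrightarrow> v \<in> M"
  using gs_in_M R2.subspace_scale[OF M] by (metis p_expansion_cases)

text \<open>Inside a block the rank is constant and each factor p lowers the order by one; from one
  block to the next the rank drops.\<close>

lemma p_expansion_sorted:
  "sorted_wrt (\<lambda>u w. lrank w < lrank u \<or> lrank w = lrank u \<and> vord p w < vord p u) (p_expansion p gs)"
  unfolding p_expansion_def
proof (rule sorted_wrt_concat_upt)
  fix j assume j: "j < length gs"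
  show "sorted_wrt (\<lambda>u w. lrank w < lrank u \<or> lrank w = lrank u \<and> vord p w < vord p u)
      (map (\<lambda>k. vscale (of_nat (p ^ k)) (gs ! j)) [0..<gb_beta p gs j])"
    using p_power_multiple[of "gs ! j"] gs_nonzero[of "gs ! j"] gb_beta_le[of p gs j] j
    by (auto simp: sorted_wrt_iff_nth_less simp del: of_nat_power)
next
  fix i j x y
  assume ij: "i < j" "j < length gs"
    and x: "x \<in> set (map (\<lambda>k. vscale (of_nat (p ^ k)) (gs ! i)) [0..<gb_beta p gs i])"
    and y: "y \<in> set (map (\<lambda>k. vscale (of_nat (p ^ k)) (gs ! j)) [0..<gb_beta p gs j])"
  have "lrank x = lrank (gs ! i)"
    using x gb_beta_le[of p gs i] p_power_multiple(2)[of "gs ! i"] gs_nonzero[of "gs ! i"] ij by auto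
  moreover have "lrank y = lrank (gs ! j)"
    using y gb_beta_le[of p gs j] p_power_multiple(2)[of "gs ! j"] gs_nonzero[of "gs ! j"] ij by auto
  ultimately show "lrank y < lrank x \<or> lrank y = lrank x \<and> vord p y < vord p x"
    using lrank_decreasing ij by simp
qed

text \<open>The numbers \<open>gb_beta\<close> are chosen such that the multiples of the last possible divisor
  \<open>gs ! j\<close> reach down to the order of the next element in the same position.\<close>

lemma ex_divisor_of_order:
  assumes "w \<in> M" "w \<noteq> 0"
  shows "\<exists>v \<in> set (p_expansion p gs). \<exists>e. lrank w = 2 * e + lrank v \<and> vord p v = vord p w"
proof -
  define Q where "Q j \<longleftrightarrow> j < length gs \<and> (\<exists>e. lrank w = 2 * e + lrank (gs ! j)) \<and>
    vord p w \<le> vord p (gs ! j)" for j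
  have "\<exists>j. Q j"
    using ex_divisor[OF assms] unfolding Q_def by (metis in_set_conv_nth)
  moreover have "\<forall>j. Q j \<longrightarrow> j \<le> length gs" by (auto simp: Q_def)
  ultimately obtain j where j: "Q j" and max: "\<And>i. Q i \<Longrightarrow> i \<le> j"
    using GreatestI_ex_nat[of Q "length gs"] Greatest_le_nat[of Q _ "length gs"] by blast
  then obtain e where e: "lrank w = 2 * e + lrank (gs ! j)" unfolding Q_def by blast
  have jl: "j < length gs" and jo: "vord p w \<le> vord p (gs ! j)" using j by (auto simp: Q_def)
  have "vord p (gs ! j) - vord p w < gb_beta p gs j"
  proof -
    define P where "P i \<longleftrightarrow> j < i \<and> i < length gs \<and> lpos (gs ! i) = lpos (gs ! j)" for i
    show ?thesis
    proof (cases "\<exists>i. P i")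
      case True
      define i where "i = (LEAST i. P i)"
      have i: "j < i" "i < length gs" "lpos (gs ! i) = lpos (gs ! j)"
        using LeastI_ex[OF True] unfolding i_def P_def by blast+
      have less: "lrank (gs ! i) < lrank (gs ! j)" using lrank_decreasing i by blast
      moreover have "even (lrank (gs ! i)) \<longleftrightarrow> even (lrank (gs ! j))"
        using i(3) lpos_eq_iff[OF gs_nonzero[OF nth_mem[OF i(2)]] gs_nonzero[OF nth_mem[OF jl]]] by simp
      ultimately have "even (lrank (gs ! j) - lrank (gs ! i))" by simp
      then obtain e' where "lrank (gs ! j) - lrank (gs ! i) = 2 * e'" by blast
      \<comment> \<open>The next element in the same position also divides \<open>lm w\<close>. As
        \<open>j\<close> is the last index satisfying \<open>Q\<close>, its order must be below that
        of \<open>w\<close>, so the exponent needed stays below \<open>gb_beta\<close>.\<close>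
      then have "lrank w = 2 * (e + e') + lrank (gs ! i)" using e less by simp
      then have "Q i" if "vord p w \<le> vord p (gs ! i)"
        unfolding Q_def using i(2) that by blast
      with max[of i] i(1) have "\<not> vord p w \<le> vord p (gs ! i)" by linarith
      moreover have "gb_beta p gs j = vord p (gs ! j) - vord p (gs ! i)"
        using True unfolding gb_beta_def Let_def i_def P_def by simp
      ultimately show ?thesis using jo by simp
    next
      case False
      then have "gb_beta p gs j = vord p (gs ! j)"
        by (simp only: gb_beta_def Let_def P_def if_False)
      then show ?thesis using jo vord_pos[OF assms(2)] by simp
    qed
  qed
  moreover define k where "k = vord p (gs ! j) - vord p w"
  ultimately have mem: "vscale (of_nat (p ^ k)) (gs ! j) \<in> set (p_expansion p gs)"
    using jl set_p_expansion by blast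
  have "gs ! j \<noteq> 0" using jl by (intro gs_nonzero nth_mem)
  moreover have "k < vord p (gs ! j)" "vord p (gs ! j) - k = vord p w"
    using jo vord_pos[OF assms(2)] by (simp_all add: k_def)
  ultimately have "lrank (vscale (of_nat (p ^ k)) (gs ! j)) = lrank (gs ! j)"
    "vord p (vscale (of_nat (p ^ k)) (gs ! j)) = vord p w"
    by (simp_all add: p_power_multiple(2,4) del: of_nat_power)
  with e show ?thesis
    by (intro bexI[OF _ mem] exI[of _ e] conjI) simp_all
qed

text \<open>The last condition says that the summand \<open>q i v_i\<close> involves only monomials up to rank \<open>m\<close>,
  and rank \<open>m\<close> only if the order of \<open>v_i\<close> is at most \<open>s\<close>. In the induction step this guarantees
  that the coefficient receiving the new digit was zero before.\<close>

lemma digit_representation: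
  assumes "w \<in> M" "\<And>m'. m < m' \<Longrightarrow> rcoeff w m' = 0" "of_nat (p ^ s) * rcoeff w m = 0"
  shows "\<exists>q. w = (\<Sum>i<length (p_expansion p gs). vscale (q i) (p_expansion p gs ! i)) \<and>
    (\<forall>i<length (p_expansion p gs). q i \<in> digit_polys p \<and> (\<forall>e. coeff (q i) e \<noteq> 0 \<longrightarrow>
      2 * e + lrank (p_expansion p gs ! i) < m \<or>
      2 * e + lrank (p_expansion p gs ! i) = m \<and> vord p (p_expansion p gs ! i) \<le> s))"
proof -
  define vs where "vs = p_expansion p gs"
  define D where "D m s q \<longleftrightarrow> (\<forall>i<length vs. q i \<in> digit_polys p \<and> (\<forall>e. coeff (q i) e \<noteq> 0 \<longrightarrow>
      2 * e + lrank (vs ! i) < m \<or> 2 * e + lrank (vs ! i) = m \<and> vord p (vs ! i) \<le> s))"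
    for m s :: nat and q :: "nat \<Rightarrow> 'a mod_ring poly"
  \<comment> \<open>Lexicographic induction on rank and order: \<open>R m s\<close> treats vectors
    bounded by rank \<open>m\<close> whose coefficient there is killed by p^s.\<close>
  define R where "R m s \<longleftrightarrow> (\<forall>w \<in> M. (\<forall>m'>m. rcoeff w m' = 0) \<and> of_nat (p ^ s) * rcoeff w m = 0 \<longrightarrow>
    (\<exists>q. w = (\<Sum>i<length vs. vscale (q i) (vs ! i)) \<and> D m s q))" for m s :: nat
  have step: "R m (Suc s)" if R: "R m s" for m s
    unfolding R_def
  proof (intro ballI impI)
    fix w assume w: "w \<in> M" "(\<forall>m'>m. rcoeff w m' = 0) \<and> of_nat (p ^ Suc s) * rcoeff w m = 0"
    show "\<exists>q. w = (\<Sum>i<length vs. vscale (q i) (vs ! i)) \<and> D m (Suc s) q"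
    proof (cases "of_nat (p ^ s) * rcoeff w m = 0")
      case True
      then obtain q where "w = (\<Sum>i<length vs. vscale (q i) (vs ! i))" "D m s q"
        using R w unfolding R_def by blast
      moreover from this(2) have "D m (Suc s) q" unfolding D_def by (meson le_SucI)
      ultimately show ?thesis by blast
    next
      case False
      then have "rcoeff w m \<noteq> 0" by auto
      then have w0: "w \<noteq> 0" "lrank w = m" using lrank_eqI[of w m] w by auto
      then have lcw: "rcoeff w m = lc w" using lm_rcoeff(2)[of w] by simp
      have "vord p w = Suc s"
        using False w add_ord_le_iff[of "lc w" s] add_ord_le_iff[of "lc w" "Suc s"]
        by (simp add: vord_def lcw del: of_nat_power power_Suc)
      then obtain i e where i: "i < length vs" "m = 2 * e + lrank (vs ! i)" "vord p (vs ! i) = Suc s"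
        using ex_divisor_of_order[OF w(1) w0(1)] w0(2) unfolding vs_def by (metis in_set_conv_nth)
      have vi: "vs ! i \<noteq> 0" "vs ! i \<in> M"
        using i(1) p_expansion_nonzero p_expansion_in_M unfolding vs_def by (meson nth_mem)+
      have "of_nat (p ^ s) * lc (vs ! i) \<noteq> 0" "of_nat (p ^ Suc s) * lc (vs ! i) = 0"
        using i(3) add_ord_le_iff[of "lc (vs ! i)" s] add_ord_le_iff[of "lc (vs ! i)" "Suc s"]
        by (simp_all add: vord_def del: of_nat_power power_Suc)
      \<comment> \<open>Multiplied by p^s, both leading coefficients become p-torsion, so one digit
        \<open>c\<close> matches them. Subtracting then lowers the order at rank
        \<open>m\<close>.\<close>
      then obtain c where c: "c \<in> digits p"
        "of_nat (p ^ s) * rcoeff w m = c * (of_nat (p ^ s) * lc (vs ! i))"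
        using p_torsion_digit_multiple[of "of_nat (p ^ s) * rcoeff w m" "of_nat (p ^ s) * lc (vs ! i)"] w
        by (auto simp: mult.assoc)
      define w' where "w' = w - vscale (monom c e) (vs ! i)"
      have "w' \<in> M"
        unfolding w'_def using M w(1) vi(2) by (intro R2.subspace_diff R2.subspace_scale)
      moreover have "rcoeff w' m' = 0" if "m < m'" for m'
        using w(2) that i(2) lm_rcoeff(4)[OF vi(1), of "m' - 2 * e"]
        by (simp add: w'_def rcoeff_diff rcoeff_vscale_monom)
      moreover have "of_nat (p ^ s) * rcoeff w' m = 0"
        using c(2) i(2) lm_rcoeff(2)[OF vi(1)]
        by (simp add: w'_def rcoeff_diff rcoeff_vscale_monom algebra_simps)
      ultimately obtain q where q: "w' = (\<Sum>i<length vs. vscale (q i) (vs ! i))" "D m s q"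
        using R unfolding R_def by blast
      define q' where "q' = q(i := q i + monom c e)"
      \<comment> \<open>\<open>D m s q\<close> admits rank \<open>m\<close> only for orders up to
        \<open>s\<close>, while v_i has order s + 1. Hence the new coefficient is \<open>c\<close>
        itself, not a sum of two digits.\<close>
      have "coeff (q i) e = 0" using q(2) i unfolding D_def by force
      then have coeff': "coeff (q' j) e' = (if j = i \<and> e' = e then c else coeff (q j) e')" for j e'
        by (auto simp: q'_def coeff_monom)
      have "D m (Suc s) q'"
        unfolding D_def
      proof (intro allI impI conjI)
        fix j assume j: "j < length vs"
        then show "q' j \<in> digit_polys p"
          using q(2) c(1) unfolding D_def digit_polys_def by (auto simp: coeff')
        fix e' assume "coeff (q' j) e' \<noteq> 0"
        then show "2 * e' + lrank (vs ! j) < m \<or>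
            2 * e' + lrank (vs ! j) = m \<and> vord p (vs ! j) \<le> Suc s"
          using q(2) j i unfolding D_def by (auto simp: coeff' split: if_splits intro: le_SucI)
      qed
      moreover have "w = (\<Sum>j<length vs. vscale (q' j) (vs ! j))"
      proof -
        have "(\<Sum>j<length vs. vscale (q' j) (vs ! j)) =
          (\<Sum>j<length vs. vscale (q j) (vs ! j) + (if j = i then vscale (monom c e) (vs ! i) else 0))"
          by (rule sum.cong) (auto simp: q'_def R2.scale_left_distrib)
        also have "\<dots> = w' + vscale (monom c e) (vs ! i)"
          using i(1) by (simp add: sum.distrib q(1) sum.delta)
        finally show ?thesis by (simp add: w'_def)
      qed
      ultimately show ?thesis by blast
    qed
  qed
  have up: "R m s" if "R m 0" for m s
    using that by (induction s) (auto intro: step)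
  have zero: "D m s (\<lambda>_. 0)" for m s
  proof -
    have "0 \<in> (digits p :: 'a mod_ring set)"
      using digitsI[of 0 p] prime_gt_0_nat[OF p] by simp
    then show ?thesis by (simp add: D_def digit_polys_def)
  qed
  have "R m 0" for m
  proof (induction m)
    case 0
    have *: "w = 0" if "\<forall>m'>0. rcoeff w m' = 0" "rcoeff w 0 = 0" for w :: "'a mod_ring poly \<times> _"
      by (rule rcoeff_eqI) (use that in \<open>metis gr0I rcoeff_0\<close>)
    then show ?case
      unfolding R_def
    proof (intro ballI impI)
      fix w :: "'a mod_ring poly \<times> 'a mod_ring poly"
      assume "(\<forall>m'>0. rcoeff w m' = 0) \<and> of_nat (p ^ 0) * rcoeff w 0 = 0"
      then have "w = 0" by (intro *) auto
      then have "w = (\<Sum>i<length vs. vscale 0 (vs ! i))" by (simp only: R2.scale_zero_left sum.neutral_const)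
      then show "\<exists>q. w = (\<Sum>i<length vs. vscale (q i) (vs ! i)) \<and> D 0 0 q"
        using zero by (intro exI[of _ "\<lambda>_. 0"] conjI)
    qed
  next
    case (Suc m)
    show ?case
      unfolding R_def
    proof (intro ballI impI)
      fix w assume w: "w \<in> M" "(\<forall>m'>Suc m. rcoeff w m' = 0) \<and> of_nat (p ^ 0) * rcoeff w (Suc m) = 0"
      \<comment> \<open>With s = 0 the coefficient at rank m + 1 vanishes. At rank \<open>m\<close>
        the exponent \<open>r\<close> kills every coefficient, so \<open>R m r\<close> takes
        over.\<close>
      then have "\<forall>m'>m. rcoeff w m' = 0" by (metis Suc_lessI mult_1 of_nat_1 power_0)
      then obtain q where "w = (\<Sum>i<length vs. vscale (q i) (vs ! i))" "D m r q"
        using up[OF Suc, of r] p_power_r_times w(1) unfolding R_def by blast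
      moreover from this(2) have "D (Suc m) 0 q" unfolding D_def by fastforce
      ultimately show "\<exists>q. w = (\<Sum>i<length vs. vscale (q i) (vs ! i)) \<and> D (Suc m) 0 q" by blast
    qed
  qed
  then have "R m s" by (rule up)
  with assms have "\<exists>q. w = (\<Sum>i<length vs. vscale (q i) (vs ! i)) \<and> D m s q"
    unfolding R_def by simp
  then show ?thesis
    unfolding D_def vs_def .
qed

text \<open>If \<open>g\<close> were larger, its leading term would be a multiple of
  \<open>lt g'\<close>, whose coefficient is a unit. This contradicts minimality of the
  basis.\<close>

lemma unit_in_first_position_maximal:
  assumes "g \<in> set gs" "g' \<in> set gs" "lpos g = 1" "lpos g' = 1" "vord p g' = r"
  shows "lrank g \<le> lrank g'"
proof (rule ccontr)
  assume "\<not> ?thesis"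
  then have less: "lrank g' < lrank g" by simp
  have nz: "g \<noteq> 0" "g' \<noteq> 0" using assms gs_nonzero by auto
  have "lc g' dvd 1" using assms(5) by (simp add: vord_def add_ord_eq_r_iff)
  then obtain b where b: "1 = lc g' * b" by (rule dvdE)
  define \<alpha> where "\<alpha> = vdeg g - vdeg g'"
  have "lm g = mon_times \<alpha> (lm g')"
    using less nz assms by (auto simp: \<alpha>_def mon_times_def vdeg_def lpos_def lrank_def mon_rank_def prod_eq_iff)
  moreover have "lt g = vscale (monom (lc g * b) \<alpha>) (lt g')"
  proof (rule rcoeff_eqI)
    fix m
    have "lrank g = 2 * \<alpha> + lrank g'"
      using arg_cong[OF \<open>lm g = _\<close>, of mon_rank] by (simp add: lrank_def mon_rank_times)
    moreover have "lc g * b * lc g' = lc g * (lc g' * b)" by (simp only: mult_ac)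
    then have "lc g * b * lc g' = lc g" by (simp only: b[symmetric] mult_1_right)
    ultimately show "rcoeff (lt g) m = rcoeff (vscale (monom (lc g * b) \<alpha>) (lt g')) m"
      by (auto simp: rcoeff_lt nz rcoeff_vscale_monom)
  qed
  moreover have "g' \<in> set gs - {g}" using assms less by auto
  ultimately have "reducible_mod (set gs - {g}) g"
    unfolding reducible_mod_def
    by (intro exI[of _ "1::nat"] exI[of _ "\<lambda>_. g'"] exI[of _ "\<lambda>_. \<alpha>"] exI[of _ "\<lambda>_. lc g * b"]) simp
  with gb assms(1) show False unfolding minimal_groebner_basis_def by blast
qed

text \<open>A factor p^k lowers the order by k, and no order exceeds r, so order r forces k =
  0.\<close>

lemma unit_p_expansion_in_gs:
  assumes "v \<in> set (p_expansion p gs)" "vord p v = r"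
  shows "v \<in> set gs"
proof -
  obtain g k where g: "g \<in> set gs" "k < vord p g" "v = vscale (of_nat (p ^ k)) g"
    using assms(1) by (rule p_expansion_cases)
  have "vord p g - k = r"
    using assms(2) p_power_multiple(4)[of g k] g gs_nonzero[of g] by simp
  moreover have "vord p g \<le> r" by (simp add: vord_def add_ord_le)
  ultimately have "k = 0" using r by simp
  then have "v = g" using g(3) by (simp add: vscale_def)
  with g(1) show ?thesis by simp
qed

end

subsection \<open>Linear recurrences as vectors of the module\<close>

text \<open>Subtracting \<open>fst w\<close> times the first generator leaves a vector that must be
  a multiple of the second, which is a congruence modulo x^(n+1).\<close>

lemma mem_seq_module_iff:
  "w \<in> seq_module n S \<longleftrightarrow> (\<forall>k\<le>n. coeff (snd w) k = - coeff (fst w * seq_poly n S) k)"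
proof -
  have "w \<in> seq_module n S \<longleftrightarrow>
    (\<exists>a b. w - vscale a (1, - seq_poly n S) = vscale b (0, monom 1 (n + 1)))"
    unfolding seq_module_def
    by (simp only: R2.span_breakdown_eq R2.span_empty singleton_iff right_minus_eq)
  also have "\<dots> \<longleftrightarrow> (\<exists>b. snd w + fst w * seq_poly n S = b * monom 1 (n + 1))"
    by (cases w) (auto simp: vscale_def)
  also have "\<dots> \<longleftrightarrow> monom 1 (n + 1) dvd snd w + fst w * seq_poly n S"
    by (auto simp: dvd_def mult.commute)
  also have "\<dots> \<longleftrightarrow> (\<forall>k\<le>n. coeff (snd w) k = - coeff (fst w * seq_poly n S) k)"
    by (simp add: monom_1_dvd_iff' less_Suc_eq_le add_eq_0_iff2)
  finally show ?thesis .
qed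

lemma coeff_seq_poly: "coeff (seq_poly n S) k = (if 1 \<le> k \<and> k \<le> n then S (n - k) else 0)"
proof -
  have "coeff (seq_poly n S) k = (\<Sum>i<n. if n - k = i then (if 1 \<le> k \<and> k \<le> n then S (n - k) else 0) else 0)"
    unfolding seq_poly_def coeff_sum by (rule sum.cong) (auto simp: coeff_monom)
  also have "\<dots> = (if 1 \<le> k \<and> k \<le> n then S (n - k) else 0)"
    by (auto simp: sum.delta)
  finally show ?thesis .
qed

text \<open>The recurrence at shift j is the coefficient of x^(n-j) in f S, and j + L < n says that
  k = n - j lies above L.\<close>

lemma lin_rec_iff:
  "lin_rec n S L f \<longleftrightarrow> degree f = L \<and> coeff f L dvd 1 \<and>
     (\<forall>k. L < k \<and> k \<le> n \<longrightarrow> coeff (f * seq_poly n S) k = 0)"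
proof -
  have sum: "coeff f L * S (L + j) + (\<Sum>i = 1..L. coeff f (L - i) * S (L + j - i))
      = coeff (f * seq_poly n S) (n - j)" if "degree f = L" "j + L < n" for j
  proof -
    have "coeff f L * S (L + j) + (\<Sum>i = 1..L. coeff f (L - i) * S (L + j - i))
      = (\<Sum>i = 0..L. coeff f (L - i) * S (L + j - i))"
      by (simp add: sum.atLeast_Suc_atMost)
    also have "\<dots> = (\<Sum>i = 0..L. coeff f i * S (i + j))"
      by (subst sum.atLeastAtMost_rev) (auto intro!: sum.cong)
    \<comment> \<open>Here i \<le> L and j + L < n give n - j - i \<ge> 1, so the zero constant
      coefficient of \<open>seq_poly\<close> is never reached.\<close>
    also have "\<dots> = (\<Sum>i \<in> {0..L}. coeff f i * coeff (seq_poly n S) (n - j - i))"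
      using that(2) by (intro sum.cong) (auto simp: coeff_seq_poly add.commute)
    also have "\<dots> = (\<Sum>i \<in> {..n - j}. coeff f i * coeff (seq_poly n S) (n - j - i))"
      using that by (intro sum.mono_neutral_left) (auto simp: coeff_eq_0)
    finally show ?thesis by (simp add: coeff_mult)
  qed
  have "(\<forall>j. j + L < n \<longrightarrow> coeff f L * S (L + j) + (\<Sum>i = 1..L. coeff f (L - i) * S (L + j - i)) = 0)
      \<longleftrightarrow> (\<forall>k. L < k \<and> k \<le> n \<longrightarrow> coeff (f * seq_poly n S) k = 0)" if "degree f = L"
  proof -
    have "(\<forall>j. j + L < n \<longrightarrow> coeff (f * seq_poly n S) (n - j) = 0)
      \<longleftrightarrow> (\<forall>k. L < k \<and> k \<le> n \<longrightarrow> coeff (f * seq_poly n S) k = 0)"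
    proof (intro iffI allI impI)
      fix k assume "\<forall>j. j + L < n \<longrightarrow> coeff (f * seq_poly n S) (n - j) = 0" "L < k \<and> k \<le> n"
      then show "coeff (f * seq_poly n S) k = 0"
        by (metis diff_diff_cancel less_diff_conv diff_less_mono2 add.commute diff_le_self
            le_add_diff_inverse2 nat_add_left_cancel_less)
    qed auto
    with sum[OF that] show ?thesis by simp
  qed
  then show ?thesis unfolding lin_rec_def by blast
qed

text \<open>Rank 2 * L + 1 is x^L e_1. The rank bound clears the second component above degree L,
  and membership transfers this to f S.\<close>

lemma lin_recI:
  assumes "w \<in> seq_module n S" "\<And>m. 2 * L + 1 < m \<Longrightarrow> rcoeff w m = 0" "rcoeff w (2 * L + 1) dvd 1"
  shows "lin_rec n S L (fst w)"
proof -
  have 1: "coeff (fst w) k = 0" if "L < k" for k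
    using assms(2)[of "2 * k + 1"] that by (simp add: rcoeff_def)
  have 2: "coeff (snd w) k = 0" if "L < k" for k
    using assms(2)[of "2 * k"] that by (simp add: rcoeff_def)
  have 3: "coeff (fst w) L dvd 1"
    using assms(3) by (simp add: rcoeff_def)
  then have "coeff (fst w) L \<noteq> 0" by auto
  then have "degree (fst w) = L" using 1 by (meson degree_le le_degree le_antisym)
  with 3 show ?thesis
    using assms(1) 2 by (auto simp: lin_rec_iff mem_seq_module_iff)
qed

lemma lin_recE:
  assumes "lin_rec n S L f"
  obtains w where "w \<in> seq_module n S" "fst w = f" "\<And>m. 2 * L + 1 < m \<Longrightarrow> rcoeff w m = 0"
    "rcoeff w (2 * L + 1) dvd 1"
proof
  \<comment> \<open>The second component is -f S truncated modulo x^(n+1); the recurrence clears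
    what remains above degree L.\<close>
  define w where "w = (f, - poly_cutoff (Suc n) (f * seq_poly n S))"
  show "w \<in> seq_module n S"
    by (simp add: mem_seq_module_iff w_def coeff_poly_cutoff)
  show "fst w = f" by (simp add: w_def)
  have L: "degree f = L" "coeff f L dvd 1"
    "\<And>k. L < k \<Longrightarrow> k \<le> n \<Longrightarrow> coeff (f * seq_poly n S) k = 0"
    using assms by (auto simp: lin_rec_iff)
  show "rcoeff w m = 0" if "2 * L + 1 < m" for m
    using that L(1) L(3)[of "m div 2"] by (auto simp: w_def rcoeff_def coeff_poly_cutoff coeff_eq_0)
  show "rcoeff w (2 * L + 1) dvd 1"
    using L(2) by (simp add: w_def rcoeff_def)
qed


text \<open>The coefficientwise form covers q = 0 and a negative integer bound uniformly, and is
  what the rank estimates consume.\<close>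

lemma degree_le_diff_iff:
  "q = 0 \<or> int (degree q) \<le> int L - int k \<longleftrightarrow> (\<forall>e. coeff q e \<noteq> 0 \<longrightarrow> e + k \<le> L)"
proof
  assume "q = 0 \<or> int (degree q) \<le> int L - int k"
  then show "\<forall>e. coeff q e \<noteq> 0 \<longrightarrow> e + k \<le> L"
    using le_degree[of q] by force
next
  assume "\<forall>e. coeff q e \<noteq> 0 \<longrightarrow> e + k \<le> L"
  then have "q \<noteq> 0 \<longrightarrow> degree q + k \<le> L" by simp
  then show "q = 0 \<or> int (degree q) \<le> int L - int k" by linarith
qed

section \<open>Minimality of the length deg v_l and the parametrization\<close>

theorem theorem4p16:
  fixes p r n l :: nat
    and S :: "nat \<Rightarrow> 'a::nontriv mod_ring"
    and v :: "nat \<Rightarrow> 'a mod_ring poly \<times> 'a mod_ring poly"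
    and d h :: "nat \<Rightarrow> 'a mod_ring poly"
  assumes "prime p" and "1 \<le> r" and "1 \<le> n"
    and "CARD('a) = p ^ r"
    and "minimal_groebner_p_basis p (seq_module n S) (map v [1..<2 * r + 1])"
    and "\<And>i. i \<in> {1..2 * r} \<Longrightarrow> v i = (d i, - h i)"
    and "l \<in> {1..2 * r}" and "lpos (v l) = 1" and "vord p (v l) = r"
  shows "shortest_lin_rec n S (d l) \<and>
    {f. shortest_lin_rec n S f} =
      {[:c:] * d l + (\<Sum>i \<in> {l<..2 * r}. q i * d i) | c q.
         c \<in> digits p \<and> c \<noteq> 0 \<and>
         (\<forall>i \<in> {l<..2 * r}. q i \<in> digit_polys p \<and>
            (q i = 0 \<or> int (degree (q i)) \<le> int (vdeg (v l)) - int (vdeg (v i))))}"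
proof -
  obtain gs where gs: "minimal_groebner_basis (seq_module n S) (set gs)"
    "sorted_wrt (\<lambda>g h. top_less (lm h) (lm g)) gs" and exp: "map v [1..<2 * r + 1] = p_expansion p gs"
    using assms(5) unfolding minimal_groebner_p_basis_def by blast
  interpret groebner_p_basis p r "TYPE('a)" "seq_module n S" gs
    using assms(1,2,4) gs by unfold_locales (auto simp: seq_module_def R2.subspace_span)
  have len: "length (p_expansion p gs) = 2 * r"
    by (simp flip: exp del: upt_Suc)
  have nth: "p_expansion p gs ! i = v (Suc i)" if "i < 2 * r" for i
    using that by (simp flip: exp del: upt_Suc)
  have mem: "v i \<in> set (p_expansion p gs)" if "i \<in> {1..2 * r}" for i
    using that by (auto simp flip: exp simp del: upt_Suc)
  note nz = p_expansion_nonzero[OF mem]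
  note in_M = p_expansion_in_M[OF mem]
  have order: "lrank (v j) < lrank (v i) \<or> lrank (v j) = lrank (v i) \<and> vord p (v j) < vord p (v i)"
    if "i < j" "i \<in> {1..2 * r}" "j \<in> {1..2 * r}" for i j
    using sorted_wrt_nth_less[OF p_expansion_sorted, of "i - 1" "j - 1"] that
    by (auto simp: len nth)
  have vord_le: "vord p w \<le> r" for w :: "'a mod_ring poly \<times> 'a mod_ring poly"
    by (simp add: vord_def add_ord_le)
  have d: "fst (v i) = d i" if "i \<in> {1..2 * r}" for i
    using assms(6)[OF that] by simp

  define L where "L = vdeg (v l)"
  have lrank_l: "lrank (v l) = 2 * L + 1"
    using lpos_eq_1_iff[OF nz, OF assms(7)] assms(8) by (auto simp: L_def vdeg_eq[OF nz, OF assms(7)])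
  have unit_l: "rcoeff (v l) (2 * L + 1) dvd 1"
    using lm_rcoeff(2)[OF nz, OF assms(7)] assms(9) lrank_l by (simp add: vord_def add_ord_eq_r_iff)
  have above_l: "rcoeff (v l) m = 0" if "2 * L + 1 < m" for m
    using lm_rcoeff(4)[OF nz, OF assms(7)] lrank_l that by simp

  have "lin_rec n S L (d l)"
    using lin_recI[OF in_M[OF assms(7)] above_l unit_l] d[OF assms(7)] by simp
  \<comment> \<open>A recurrence of length L' yields a vector of order r and odd rank 2 * L' + 1.
    Its divisor in the basis has order r and position 1, hence rank at least that of
    \<open>v l\<close>.\<close>
  moreover have minimal: "L \<le> L'" if "lin_rec n S L' f" for L' f
  proof -
    obtain w where w: "w \<in> seq_module n S" "\<And>m. 2 * L' + 1 < m \<Longrightarrow> rcoeff w m = 0"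
      "rcoeff w (2 * L' + 1) dvd 1"
      using \<open>lin_rec n S L' f\<close> by (rule lin_recE) blast
    then have "rcoeff w (2 * L' + 1) \<noteq> 0" by auto
    then have w0: "w \<noteq> 0" "lrank w = 2 * L' + 1" using lrank_eqI[of w] w(2) by blast+
    then have "vord p w = r"
      using lm_rcoeff(2)[OF w0(1)] w(3) by (simp add: vord_def add_ord_eq_r_iff)
    then obtain g e where g: "g \<in> set gs" "2 * L' + 1 = 2 * e + lrank g" "r \<le> vord p g"
      using ex_divisor[OF w(1) w0(1)] w0(2) by auto
    have "odd (lrank g)" using g(2) by presburger
    then have "lpos g = 1" using lpos_eq_1_iff[OF gs_nonzero[OF g(1)]] by simp
    moreover have "vord p g = r" using g(3) vord_le[of g] by simp
    ultimately have "lrank (v l) \<le> lrank g"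
      using unit_in_first_position_maximal unit_p_expansion_in_gs[OF mem] assms(7-9) g(1) by blast
    then show ?thesis using g(2) lrank_l by simp
  qed
  ultimately have shortest_iff: "shortest_lin_rec n S f \<longleftrightarrow> lin_rec n S L f" for f
    unfolding shortest_lin_rec_def using le_antisym by blast

  \<comment> \<open>The odd rank 2 * vdeg + 1 serves as a bound in both positions. In position 2 the
    coefficient there is 0; in position 1 it is a nonunit leading coefficient.\<close>
  have after: "vdeg (v i) \<le> L" "\<And>m. 2 * vdeg (v i) + 1 < m \<Longrightarrow> rcoeff (v i) m = 0"
    "of_nat (p ^ (r - 1)) * rcoeff (v i) (2 * vdeg (v i) + 1) = 0"
    if i: "i \<in> {l<..2 * r}" for i
  proof -
    have i': "i \<in> {1..2 * r}" "l < i" using i assms(7) by auto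
    have deg: "vdeg (v i) = lrank (v i) div 2" by (rule vdeg_eq[OF nz[OF i'(1)]])
    have ord: "lrank (v i) < lrank (v l) \<or> lrank (v i) = lrank (v l) \<and> vord p (v i) < r"
      using order[OF i'(2) assms(7) i'(1)] assms(9) by simp
    show "vdeg (v i) \<le> L" using ord lrank_l deg by auto
    show zero: "rcoeff (v i) m = 0" if "2 * vdeg (v i) + 1 < m" for m
      using lm_rcoeff(4)[OF nz[OF i'(1)], of m] that deg by simp
    show "of_nat (p ^ (r - 1)) * rcoeff (v i) (2 * vdeg (v i) + 1) = 0"
    proof (cases "odd (lrank (v i))")
      case True
      then have lpos: "lpos (v i) = 1" using lpos_eq_1_iff[OF nz[OF i'(1)]] by simp
      have "vord p (v i) \<noteq> r"
      proof
        assume "vord p (v i) = r"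
        \<comment> \<open>Sorting allows this only with equal ranks and order below r.\<close>
        then have "lrank (v l) \<le> lrank (v i)"
          using unit_in_first_position_maximal unit_p_expansion_in_gs[OF mem] assms(7-9) i'(1) lpos
          by blast
        with ord \<open>vord p (v i) = r\<close> show False by simp
      qed
      then have "add_ord p (lc (v i)) \<le> r - 1" using vord_le[of "v i"] by (simp add: vord_def)
      then have "of_nat (p ^ (r - 1)) * lc (v i) = 0" by (simp only: add_ord_le_iff)
      moreover have "2 * vdeg (v i) + 1 = lrank (v i)" using True deg by simp
      ultimately show ?thesis using lm_rcoeff(2)[OF nz[OF i'(1)]] by (simp only:)
    next
      case False
      then have "lrank (v i) < 2 * vdeg (v i) + 1" using deg by simp
      then have "rcoeff (v i) (2 * vdeg (v i) + 1) = 0" by (rule lm_rcoeff(4)[OF nz[OF i'(1)]])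
      then show ?thesis by (simp only: mult_zero_right)
    qed
  qed

  have tail: "rcoeff (\<Sum>i\<in>{l<..2 * r}. vscale (q i) (v i)) m = 0"
    "of_nat (p ^ (r - 1)) * rcoeff (\<Sum>i\<in>{l<..2 * r}. vscale (q i) (v i)) (2 * L + 1) = 0"
    if q: "\<forall>i\<in>{l<..2 * r}. \<forall>e. coeff (q i) e \<noteq> 0 \<longrightarrow> e + vdeg (v i) \<le> L" and m: "2 * L + 1 < m"
    for q m
  proof -
    have q': "2 * e + (2 * vdeg (v i) + 1) \<le> 2 * L + 1" if "i \<in> {l<..2 * r}" "coeff (q i) e \<noteq> 0" for i e
      using q that by fastforce
    show "rcoeff (\<Sum>i\<in>{l<..2 * r}. vscale (q i) (v i)) m = 0"
      unfolding rcoeff_sum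
      by (intro sum.neutral ballI rcoeff_vscale_above[OF after(2) q' m])
    show "of_nat (p ^ (r - 1)) * rcoeff (\<Sum>i\<in>{l<..2 * r}. vscale (q i) (v i)) (2 * L + 1) = 0"
      unfolding rcoeff_sum sum_distrib_left
      by (intro sum.neutral ballI rcoeff_vscale_top[OF after(2) q' after(3)])
  qed

  have const: "rcoeff (vscale [:c:] (v l)) m = c * rcoeff (v l) m" for c m
    using rcoeff_vscale_monom[of c 0 "v l" m] by (simp add: monom_0)

  have fst_combination: "fst (vscale a (v l) + (\<Sum>i\<in>{l<..2 * r}. vscale (q i) (v i))) =
      a * d l + (\<Sum>i\<in>{l<..2 * r}. q i * d i)" for a q
  proof -
    have "(\<Sum>i\<in>{l<..2 * r}. q i * fst (v i)) = (\<Sum>i\<in>{l<..2 * r}. q i * d i)"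
      using assms(7) by (intro sum.cong) (auto simp: d)
    then show ?thesis by (simp add: fst_sum vscale_def d[OF assms(7)])
  qed

  have "{f. lin_rec n S L f} =
      {[:c:] * d l + (\<Sum>i \<in> {l<..2 * r}. q i * d i) | c q.
         c \<in> digits p \<and> c \<noteq> 0 \<and>
         (\<forall>i \<in> {l<..2 * r}. q i \<in> digit_polys p \<and>
            (\<forall>e. coeff (q i) e \<noteq> 0 \<longrightarrow> e + vdeg (v i) \<le> L))}" (is "_ = ?P")
  proof (intro equalityI subsetI)
    fix f assume "f \<in> ?P"
    then obtain c q where f: "f = [:c:] * d l + (\<Sum>i \<in> {l<..2 * r}. q i * d i)"
      and c: "c \<in> digits p" "c \<noteq> 0"
      and q: "\<forall>i\<in>{l<..2 * r}. \<forall>e. coeff (q i) e \<noteq> 0 \<longrightarrow> e + vdeg (v i) \<le> L"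
      by blast
    define w where "w = vscale [:c:] (v l) + (\<Sum>i\<in>{l<..2 * r}. vscale (q i) (v i))"
    have "w \<in> seq_module n S"
      unfolding w_def using assms(7) in_M
      by (intro R2.subspace_add[OF M] R2.subspace_sum[OF M] R2.subspace_scale[OF M]) auto
    moreover have "rcoeff w m = 0" if "2 * L + 1 < m" for m
      unfolding w_def rcoeff_add const using tail(1)[OF q that] above_l[OF that] by simp
    moreover have "rcoeff w (2 * L + 1) dvd 1"
    proof -
      \<comment> \<open>The tail dies under p^(r-1), so the unit test sees only \<open>c\<close>
        times the unit coefficient of \<open>v l\<close>.\<close>
      have "of_nat (p ^ (r - 1)) * rcoeff w (2 * L + 1) =
          of_nat (p ^ (r - 1)) * (c * rcoeff (v l) (2 * L + 1))"
        unfolding w_def rcoeff_add const distrib_left using tail(2)[OF q lessI] by simp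
      moreover have "c * rcoeff (v l) (2 * L + 1) dvd 1"
        using mult_dvd_mono[OF nonzero_digit_dvd_one[OF c] unit_l] by simp
      ultimately show ?thesis by (simp only: dvd_one_iff not_False_eq_True)
    qed
    ultimately have "lin_rec n S L (fst w)" by (rule lin_recI)
    then show "f \<in> {f. lin_rec n S L f}" unfolding w_def fst_combination f by simp
  next
    fix f assume "f \<in> {f. lin_rec n S L f}"
    then have "lin_rec n S L f" by simp
    then obtain w where w: "w \<in> seq_module n S" "fst w = f" "\<And>m. 2 * L + 1 < m \<Longrightarrow> rcoeff w m = 0"
      "rcoeff w (2 * L + 1) dvd 1"
      by (rule lin_recE) blast
    obtain q where q: "w = (\<Sum>i<2 * r. vscale (q i) (v (Suc i)))"
      "\<And>i. i < 2 * r \<Longrightarrow> q i \<in> digit_polys p"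
      "\<And>i e. i < 2 * r \<Longrightarrow> coeff (q i) e \<noteq> 0 \<Longrightarrow> 2 * e + lrank (v (Suc i)) \<le> 2 * L + 1"
    proof -
      obtain q where q: "w = (\<Sum>i<2 * r. vscale (q i) (p_expansion p gs ! i))"
        "\<forall>i<2 * r. q i \<in> digit_polys p \<and> (\<forall>e. coeff (q i) e \<noteq> 0 \<longrightarrow>
          2 * e + lrank (p_expansion p gs ! i) < 2 * L + 1 \<or>
          2 * e + lrank (p_expansion p gs ! i) = 2 * L + 1 \<and> vord p (p_expansion p gs ! i) \<le> r)"
        \<comment> \<open>Taking s = r fits any coefficient at rank 2 * L + 1, because p^r
          annihilates the ring.\<close>
        using digit_representation[OF w(1,3) p_power_r_times] unfolding len by blast
      show thesis
      proof (rule that)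
        show "w = (\<Sum>i<2 * r. vscale (q i) (v (Suc i)))" unfolding q(1) by (simp add: nth)
        show "q i \<in> digit_polys p" if "i < 2 * r" for i using q(2) that by blast
        show "2 * e + lrank (v (Suc i)) \<le> 2 * L + 1" if "i < 2 * r" "coeff (q i) e \<noteq> 0" for i e
          using q(2) that nth[OF that(1)] by (metis less_imp_le order_refl)
      qed
    qed
    define q' where "q' i = q (i - 1)" for i
    have q': "q' i \<in> digit_polys p" "\<And>e. coeff (q' i) e \<noteq> 0 \<Longrightarrow> 2 * e + lrank (v i) \<le> 2 * L + 1"
      if "i \<in> {1..2 * r}" for i
      using that q(2)[of "i - 1"] q(3)[of "i - 1"] by (auto simp: q'_def)
    have before: "q' i = 0" if "i \<in> {1..<l}" for i
    proof -
      have i: "i < l" "i \<in> {1..2 * r}" using that assms(7) by auto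
      \<comment> \<open>Equal ranks would require an order above r, so no element before
        \<open>v l\<close> fits under the bound.\<close>
      have "2 * L + 1 < lrank (v i)"
        using order[OF i assms(7)] assms(9) vord_le[of "v i"] lrank_l by auto
      then have "coeff (q' i) e = 0" for e using q'(2)[OF i(2), of e] by fastforce
      then show ?thesis by (simp add: poly_eq_iff)
    qed
    define c where "c = coeff (q' l) 0"
    \<comment> \<open>\<open>v l\<close> already has rank 2 * L + 1, leaving no room for a positive
      power of x.\<close>
    have "coeff (q' l) e = 0" if "e \<noteq> 0" for e
      using q'(2)[OF assms(7), of e] lrank_l that by fastforce
    then have ql: "q' l = [:c:]"
      by (auto simp: poly_eq_iff c_def coeff_pCons split: nat.split)
    have "w = (\<Sum>i\<in>{1..2 * r}. vscale (q' i) (v i))"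
      unfolding q(1) by (rule sum.reindex_bij_witness[of _ "\<lambda>i. i - 1" Suc]) (auto simp: q'_def)
    also have "\<dots> = (\<Sum>i\<in>{l..2 * r}. vscale (q' i) (v i))"
      using assms(7) before by (intro sum.mono_neutral_right) auto
    also have "{l..2 * r} = insert l {l<..2 * r}" using assms(7) by auto
    also have "(\<Sum>i\<in>insert l {l<..2 * r}. vscale (q' i) (v i)) =
        vscale [:c:] (v l) + (\<Sum>i\<in>{l<..2 * r}. vscale (q' i) (v i))"
      by (simp add: ql)
    finally have w_eq: "w = vscale [:c:] (v l) + (\<Sum>i\<in>{l<..2 * r}. vscale (q' i) (v i))" .
    have bound: "\<forall>i\<in>{l<..2 * r}. \<forall>e. coeff (q' i) e \<noteq> 0 \<longrightarrow> e + vdeg (v i) \<le> L"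
    proof (intro ballI allI impI)
      fix i e assume "i \<in> {l<..2 * r}" "coeff (q' i) e \<noteq> 0"
      moreover from this have i: "i \<in> {1..2 * r}" using assms(7) by auto
      ultimately show "e + vdeg (v i) \<le> L" using q'(2)[OF i] vdeg_eq[OF nz[OF i]] by fastforce
    qed
    have "c \<noteq> 0"
    proof
      assume "c = 0"
      \<comment> \<open>Without \<open>v l\<close> only the tail remains, so the coefficient of x^L
        e_1 could not be a unit.\<close>
      then have "of_nat (p ^ (r - 1)) * rcoeff w (2 * L + 1) = 0"
        unfolding w_eq rcoeff_add const using tail(2)[OF bound lessI] by simp
      with w(4) show False unfolding dvd_one_iff by blast
    qed
    moreover have "c \<in> digits p" using q'(1)[OF assms(7)] by (simp add: c_def digit_polys_def)
    moreover have "\<forall>i\<in>{l<..2 * r}. q' i \<in> digit_polys p" using q'(1) assms(7) by auto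
    moreover have "f = [:c:] * d l + (\<Sum>i \<in> {l<..2 * r}. q' i * d i)"
      using w(2) unfolding w_eq fst_combination by simp
    ultimately show "f \<in> ?P" using bound by blast
  qed
  then show ?thesis
    using \<open>lin_rec n S L (d l)\<close>
    by (simp only: shortest_iff degree_le_diff_iff L_def[symmetric] simp_thms)
qed

end
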